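(* Let $N\ge 1$ be an integer, $\lambda>1$, $c_0,\dots,c_N\in\mathbb{C}$ and $\beta_0<\beta_1<\dots<\beta_N$ real numbers. Suppose $\phi\in L^1(\mathbb{R})\setminus\{0\}$ has compact support and satisfies $$\phi(x)=\sum_{k=0}^{N}c_k\,\phi(\lambda x-\beta_k)\quad\text{for almost every }x\in\mathbb{R}.$$ Then $|c_0|<\lambda$ and $|c_N|<\lambda$. Further, let $\mu\ge 0$. If $|\phi(x)|/|x-a|^{\mu}$ is bounded for almost all $x$ in a neighborhood of $a=(\lambda-1)^{-1}\beta_0$, then $|c_0|\le\lambda^{-\mu}$. Likewise, if $|\phi(x)|/|x-a|^{\mu}$ is bounded for almost all $x$ in a neighborhood of $a=(\lambda-1)^{-1}\beta_N$, then $|c_N|\le\lambda^{-\mu}$.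
   Context: Functions in $L^1(\mathbb{R})$ are complex-valued and identified when equal almost everywhere; $\phi$ has compact support if it vanishes almost everywhere outside a compact set. *)

theory Defs
  imports "HOL-Analysis.Analysis"
begin

definition ae_compact_support :: "(real \<Rightarrow> complex) \<Rightarrow> bool" where
  "ae_compact_support f \<longleftrightarrow>
     (\<exists>K. compact K \<and> (AE x in lebesgue. x \<notin> K \<longrightarrow> f x = 0))"

definition ae_bounded_near :: "(real \<Rightarrow> real) \<Rightarrow> real \<Rightarrow> bool" where
  "ae_bounded_near g a \<longleftrightarrow>
     (\<exists>U M. open U \<and> a \<in> U \<and> (AE x in lebesgue. x \<in> U \<longrightarrow> \<bar>g x\<bar> \<le> M))"

end

theory Submission
  imports Defs
begin

text \<open>
  Let \<open>s\<close> be the left end of the essential support of \<open>\<phi>\<close>. If \<open>c\<^sub>0 \<noteq> 0\<close>, then the leftmost term of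
  the equation forces \<open>s = (s + \<beta>\<^sub>0) / \<lambda>\<close>, that is \<open>s = \<beta>\<^sub>0 / (\<lambda> - 1)\<close>, and immediately to the right of \<open>s\<close> only
  this term contributes. So \<open>J(r) = \<integral>\<^bsub>x < s + r\<^esub> |\<phi>|\<close> satisfies \<open>J(r) = |c\<^sub>0| / \<lambda> \<sqdot> J(\<lambda>r)\<close> for small \<open>r > 0\<close>,
  hence \<open>J(\<delta> / \<lambda>\<^sup>n) = (|c\<^sub>0| / \<lambda>)\<^sup>n J(\<delta>)\<close>. Here \<open>J(\<delta>) > 0\<close> and \<open>J(r) \<rightarrow> 0\<close> as \<open>r \<rightarrow> 0\<close>, which gives
  \<open>|c\<^sub>0| < \<lambda>\<close>; an order \<open>\<mu>\<close> bound on \<open>\<phi>\<close> near \<open>s\<close> gives \<open>J(r) = O(r\<^bsup>\<mu> + 1\<^esup>)\<close> and thus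
  \<open>|c\<^sub>0| \<le> \<lambda>\<^bsup>- \<mu>\<^esup>\<close>. The right end follows by reflection.
\<close>

section \<open>Null sets under affine maps, and the essential support\<close>

lemma AE_lebesgue_affine:
  fixes P :: "real \<Rightarrow> bool"
  assumes "c \<noteq> 0" "AE x in lebesgue. P x"
  shows "AE x in lebesgue. P (t + c * x)"
proof -
  \<comment> \<open>A Lebesgue null set lies in a Borel null set, so invariance under affine maps
    need only be known for \<open>lborel\<close>.\<close>
  obtain N where N: "{x. \<not> P x} \<subseteq> N" "N \<in> null_sets lborel"
    using assms(2) unfolding AE_completion_iff by (auto simp: eventually_ae_filter)
  have "AE x in lborel. t + c * x \<notin> N"
    by (rule AE_borel_affine[OF assms(1), of "\<lambda>x. x \<notin> N"]) (use N AE_not_in[of N lborel] in auto)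
  then show ?thesis
    unfolding AE_completion_iff by eventually_elim (use N(1) in auto)
qed

lemma AE_lebesgue_uminus:
  fixes P :: "real \<Rightarrow> bool"
  shows "AE x in lebesgue. P x \<Longrightarrow> AE x in lebesgue. P (- x)"
  using AE_lebesgue_affine[of "- 1" P 0] by simp

text \<open>The admissible \<open>u\<close> form a set that is closed downwards, nonempty by
  \<open>bd\<close>, and bounded above because \<open>f\<close> is not almost everywhere zero. It
  contains its supremum, since a countable union of null sets is null, so it is a closed half-line
  ending at \<open>s\<close>.\<close>

lemma essential_support_left_end:
  fixes f :: "real \<Rightarrow> 'a::zero"
  assumes nz: "\<not> (AE x in lebesgue. f x = 0)" and bd: "AE x in lebesgue. x < m \<longrightarrow> f x = 0"
  obtains s where "\<And>u. (AE x in lebesgue. x < u \<longrightarrow> f x = 0) \<longleftrightarrow> u \<le> s"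
proof -
  define Z where "Z = {u. AE x in lebesgue. x < u \<longrightarrow> f x = 0}"
  have down: "u \<in> Z" if "v \<in> Z" "u \<le> v" for u v
    using that(1) unfolding Z_def mem_Collect_eq by eventually_elim (use that(2) in auto)
  have closed: "u \<in> Z" if "\<And>n::nat. u - inverse (Suc n) \<in> Z" for u
  proof -
    have "AE x in lebesgue. \<forall>n::nat. x < u - inverse (Suc n) \<longrightarrow> f x = 0"
      using that unfolding Z_def AE_all_countable by blast
    then have "AE x in lebesgue. x < u \<longrightarrow> f x = 0"
    proof eventually_elim
      case (elim x)
      show ?case
      proof
        assume "x < u"
        then obtain n where "inverse (real (Suc n)) < u - x"
          using reals_Archimedean[of "u - x"] by auto
        then show "f x = 0" using elim by (auto simp: algebra_simps)
      qed
    qed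
    then show ?thesis by (simp add: Z_def)
  qed
  have bdd: "bdd_above Z"
  proof (rule ccontr)
    assume "\<not> bdd_above Z"
    then have "real n \<in> Z" for n
      unfolding bdd_above_def using down by (meson linear)
    then have "AE x in lebesgue. \<forall>n::nat. x < real n \<longrightarrow> f x = 0"
      unfolding Z_def AE_all_countable by blast
    then have "AE x in lebesgue. f x = 0"
      by eventually_elim (use reals_Archimedean2 in blast)
    with nz show False by simp
  qed
  have ne: "Z \<noteq> {}" using bd by (auto simp: Z_def)
  have "Sup Z \<in> Z"
  proof (rule closed)
    fix n :: nat
    obtain v where "v \<in> Z" "Sup Z - inverse (Suc n) < v"
      using less_cSup_iff[OF ne bdd, of "Sup Z - inverse (Suc n)"] by auto
    then show "Sup Z - inverse (Suc n) \<in> Z" using down by auto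
  qed
  then have "u \<in> Z \<longleftrightarrow> u \<le> Sup Z" for u
    using down cSup_upper[OF _ bdd] by blast
  then show thesis using that unfolding Z_def by blast
qed

section \<open>Decay of the mass near the left end\<close>

text \<open>The substitution \<open>y = l * x - b\<close> fixes \<open>s\<close>, carries
  \<open>x < s + r\<close> to \<open>y < s + l * r\<close>, and contributes the factor
  \<open>1 / l\<close>. The condition \<open>r \<le> d\<close> keeps \<open>x\<close> inside the
  range of the one-term equation.\<close>

lemma left_mass_scaling:
  fixes f :: "real \<Rightarrow> complex"
  assumes l: "l > 0" and int: "integrable lebesgue f" and fx: "l * s - b = s"
    and eq: "AE x in lebesgue. x < s + d \<longrightarrow> f x = c * f (l * x - b)"
    and r: "r \<le> d"
  shows "(\<integral>x. indicator {..<s + r} x * cmod (f x) \<partial>lebesgue)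
    = cmod c / l * (\<integral>x. indicator {..<s + l * r} x * cmod (f x) \<partial>lebesgue)"
    (is "?J r = _ * ?J (l * r)")
proof -
  have intJ: "integrable lebesgue (\<lambda>x. indicator {..<s + r} x * cmod (f x))" for r
    using integrable_mult_indicator[OF _ integrable_norm[OF int], of "{..<s + r}"] by simp
  let ?g = "\<lambda>x. indicator {..<s + l * r} x * cmod (f x)"
  have ind: "indicator {..<s + l * r} (- b + l * x) = (indicator {..<s + r} x :: real)" for x
  proof -
    have "- b + l * x < s + l * r \<longleftrightarrow> l * x < l * (s + r)"
      using fx by (auto simp: algebra_simps)
    also have "\<dots> \<longleftrightarrow> x < s + r" using l by simp
    finally show ?thesis by (simp add: indicator_def)
  qed
  have "?J r = (\<integral>x. cmod c * ?g (- b + l * x) \<partial>lebesgue)"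
  proof (rule integral_cong_AE)
    show "(\<lambda>x. indicator {..<s + r} x * cmod (f x)) \<in> borel_measurable lebesgue"
      using intJ by (rule borel_measurable_integrable)
    show "(\<lambda>x. cmod c * ?g (- b + l * x)) \<in> borel_measurable lebesgue"
      using lebesgue_integrable_real_affine[OF intJ[of "l * r"], of l "- b"] l
      by (intro borel_measurable_integrable integrable_mult_right) auto
    show "AE x in lebesgue. indicator {..<s + r} x * cmod (f x) = cmod c * ?g (- b + l * x)"
      using eq
    proof eventually_elim
      case (elim x)
      then show ?case unfolding ind using r
        by (auto simp: indicator_def norm_mult algebra_simps)
    qed
  qed
  also have "\<dots> = cmod c / l * ?J (l * r)"
    using lebesgue_integral_real_affine[of l ?g "- b"] l by simp
  finally show ?thesis .
qed

text \<open>This isolates the one-term situation at the left end. One direction of the equivalence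
  for \<open>s\<close> makes \<open>f\<close> vanish to its left, the other makes the mass just to
  its right positive.\<close>

lemma dilation_coefficient_bounds:
  fixes f :: "real \<Rightarrow> complex"
  assumes l: "l > 1" and int: "integrable lebesgue f"
    and s: "\<And>u. (AE x in lebesgue. x < u \<longrightarrow> f x = 0) \<longleftrightarrow> u \<le> s"
    and fx: "l * s - b = s" and d: "d > 0"
    and eq: "AE x in lebesgue. x < s + d \<longrightarrow> f x = c * f (l * x - b)"
  shows "cmod c < l"
    and "\<mu> \<ge> 0 \<Longrightarrow> ae_bounded_near (\<lambda>x. cmod (f x) / \<bar>x - s\<bar> powr \<mu>) s \<Longrightarrow> cmod c \<le> l powr - \<mu>"
proof -
  define J where "J r = (\<integral>x. indicator {..<s + r} x * cmod (f x) \<partial>lebesgue)" for r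
  have intJ: "integrable lebesgue (\<lambda>x. indicator {..<s + r} x * cmod (f x))" for r
    using integrable_mult_indicator[OF _ integrable_norm[OF int], of "{..<s + r}"] by simp
  define q where "q = cmod c / l"
  \<comment> \<open>These scales shrink to 0, stay at most \<open>d\<close>, and satisfy
    \<open>l * e (Suc n) = e n\<close>, so the scaling relation can be iterated along them.\<close>
  define e where "e n = d / l ^ n" for n
  have e: "e n > 0" "e n \<le> d" for n
    using l d by (simp_all add: e_def divide_le_eq one_le_power)
  have e0: "e \<longlonglongrightarrow> 0"
    unfolding e_def by (rule LIMSEQ_divide_realpow_zero[OF l])
  \<comment> \<open>Zero mass would make \<open>f\<close> vanish left of \<open>s + d\<close>,
    against the maximality of \<open>s\<close>.\<close>
  have Jd: "J d > 0"
  proof -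
    have "J d \<ge> 0" unfolding J_def by (rule integral_nonneg_AE) auto
    moreover have "J d \<noteq> 0"
    proof
      assume "J d = 0"
      then have "AE x in lebesgue. indicator {..<s + d} x * cmod (f x) = 0"
        using integral_nonneg_eq_0_iff_AE[OF intJ[of d]] by (auto simp: J_def)
      then have "AE x in lebesgue. x < s + d \<longrightarrow> f x = 0"
        by eventually_elim (auto simp: indicator_def split: if_splits)
      then show False using s[of "s + d"] d by simp
    qed
    ultimately show ?thesis by simp
  qed
  have Je: "J (e n) = q ^ n * J d" for n
  proof (induction n)
    case (Suc n)
    have "J (e (Suc n)) = q * J (l * e (Suc n))"
      unfolding J_def q_def using left_mass_scaling[OF _ int fx eq e(2)] l by simp
    also have "l * e (Suc n) = e n" using l by (simp add: e_def)
    finally show ?case using Suc by simp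
  qed (simp add: e_def)
  have zero: "AE x in lebesgue. x < s \<longrightarrow> f x = 0" using s by blast
  \<comment> \<open>At \<open>x = s\<close> every indicator below equals 1, so pointwise convergence
    to 0 may fail there. The bound of order \<open>\<mu>\<close> is also uninformative at
    \<open>s\<close>, where its denominator is 0.\<close>
  have ns: "AE x in lebesgue. x \<noteq> s"
    unfolding AE_completion_iff by (rule AE_lborel_singleton)
  have "(\<lambda>n. J (e n)) \<longlonglongrightarrow> (\<integral>(x::real). 0 \<partial>lebesgue)"
    unfolding J_def
  proof (rule integral_dominated_convergence)
    show "integrable lebesgue (\<lambda>x. cmod (f x))" using int by simp
    show "AE x in lebesgue. norm (indicator {..<s + e n} x * cmod (f x)) \<le> cmod (f x)" for n
      by (auto simp: indicator_def)
    show "AE x in lebesgue. (\<lambda>n. indicator {..<s + e n} x * cmod (f x)) \<longlonglongrightarrow> 0"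
      using zero ns
    proof eventually_elim
      case (elim x)
      show ?case
      proof (cases "x < s")
        case False
        with elim have "x - s > 0" by simp
        from order_tendstoD(2)[OF e0 this]
        have "\<forall>\<^sub>F n in sequentially. indicator {..<s + e n} x * cmod (f x) = 0"
          by eventually_elim (auto simp: indicator_def)
        then show ?thesis by (rule tendsto_eventually)
      qed (use elim in auto)
    qed
  qed (use borel_measurable_integrable[OF intJ] in simp_all)
  then have lim: "(\<lambda>n. q ^ n * J d) \<longlonglongrightarrow> 0" by (simp add: Je)
  have "q < 1"
  proof (rule ccontr)
    assume "\<not> q < 1"
    then have "J d \<le> q ^ n * J d" for n using Jd by (simp add: one_le_power)
    then have "J d \<le> 0" using LIMSEQ_le_const[OF lim] by blast
    with Jd show False by simp
  qed
  then show "cmod c < l" using l by (simp add: q_def divide_less_eq)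
  assume mu: "\<mu> \<ge> 0" and "ae_bounded_near (\<lambda>x. cmod (f x) / \<bar>x - s\<bar> powr \<mu>) s"
  then obtain U M where U: "open U" "s \<in> U"
    and M: "AE x in lebesgue. x \<in> U \<longrightarrow> \<bar>cmod (f x) / \<bar>x - s\<bar> powr \<mu>\<bar> \<le> M"
    unfolding ae_bounded_near_def by blast
  obtain h where h: "h > 0" "ball s h \<subseteq> U" using U openE by blast
  \<comment> \<open>Up to a null set the integrand lives on an interval of length \<open>r\<close>,
    where \<open>cmod (f x)\<close> is at most \<open>\<bar>M\<bar> * r powr \<mu>\<close>; this
    uses \<open>\<mu> \<ge> 0\<close>. The absolute value of \<open>M\<close> supplies the
    nonnegativity that monotonicity of the product needs.\<close>
  have bound: "J r \<le> \<bar>M\<bar> * r powr (\<mu> + 1)" if r: "0 < r" "r < h" for r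
  proof -
    have ic: "integrable lebesgue (\<lambda>x. indicator {s..<s + r} x * (\<bar>M\<bar> * r powr \<mu>))"
      by (intro integrable_mult_left integrable_real_indicator) (use r in auto)
    have "J r \<le> (\<integral>x. indicator {s..<s + r} x * (\<bar>M\<bar> * r powr \<mu>) \<partial>lebesgue)"
      unfolding J_def
    proof (rule integral_mono_AE[OF intJ ic])
      show "AE x in lebesgue. indicator {..<s + r} x * cmod (f x)
          \<le> indicator {s..<s + r} x * (\<bar>M\<bar> * r powr \<mu>)"
        using zero ns M
      proof eventually_elim
        case (elim x)
        show ?case
        proof (cases "s < x \<and> x < s + r")
          case True
          then have "x \<in> U" using r h(2) by (auto simp: subset_eq dist_real_def)
          then have "cmod (f x) / \<bar>x - s\<bar> powr \<mu> \<le> M" using elim by auto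
          then have "cmod (f x) \<le> M * \<bar>x - s\<bar> powr \<mu>" using True by (simp add: divide_le_eq)
          also have "\<dots> \<le> \<bar>M\<bar> * r powr \<mu>"
            using True mu by (intro mult_mono powr_mono2) auto
          finally show ?thesis using True by (simp add: indicator_def)
        qed (use elim in \<open>auto simp: indicator_def\<close>)
      qed
    qed
    also have "\<dots> = \<bar>M\<bar> * r powr (\<mu> + 1)" using r by (simp add: powr_add)
    finally show ?thesis .
  qed
  \<comment> \<open>Comparing \<open>J (e n) = q ^ n * J d\<close> with the bound at
    \<open>r = e n\<close> leaves powers of \<open>q * l powr (\<mu> + 1)\<close>, which is
    \<open>p\<close>. Bounded powers force \<open>p \<le> 1\<close>, the claim.\<close>
  define p where "p = cmod c * l powr \<mu>"
  have "\<forall>\<^sub>F n in sequentially. p ^ n * J d \<le> \<bar>M\<bar> * d powr (\<mu> + 1)"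
    using order_tendstoD(2)[OF e0 h(1)]
  proof eventually_elim
    case (elim n)
    have "q ^ n * J d \<le> \<bar>M\<bar> * e n powr (\<mu> + 1)"
      using bound[OF e(1) elim] by (simp add: Je)
    also have "e n powr (\<mu> + 1) = d powr (\<mu> + 1) / (l powr (\<mu> + 1)) ^ n"
      using l d by (simp add: e_def powr_divide powr_powr powr_realpow[symmetric] mult.commute)
    finally have "q ^ n * (l powr (\<mu> + 1)) ^ n * J d \<le> \<bar>M\<bar> * d powr (\<mu> + 1)"
      using l by (simp add: field_simps)
    moreover have "q * l powr (\<mu> + 1) = p" using l by (simp add: q_def p_def powr_add)
    ultimately show ?case by (simp flip: power_mult_distrib)
  qed
  then have ub: "\<forall>\<^sub>F n in sequentially. p ^ n \<le> \<bar>M\<bar> * d powr (\<mu> + 1) / J d"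
    by eventually_elim (use Jd in \<open>simp add: field_simps\<close>)
  have "p \<le> 1"
  proof (rule ccontr)
    assume "\<not> p \<le> 1"
    then have "\<forall>\<^sub>F n in sequentially. \<bar>M\<bar> * d powr (\<mu> + 1) / J d < p ^ n"
      using real_arch_pow[of p "\<bar>M\<bar> * d powr (\<mu> + 1) / J d"] power_increasing[of _ _ p]
      unfolding eventually_sequentially by (meson less_le_not_le linorder_not_le order_less_le_trans)
    with ub have "\<forall>\<^sub>F n::nat in sequentially. False" by eventually_elim simp
    then show False by simp
  qed
  then show "cmod c \<le> l powr - \<mu>" using l by (simp add: p_def powr_minus field_simps)
qed

section \<open>Reduction of the refinement equation to its leftmost term\<close>

lemma refinement_left_coefficient:
  fixes c :: "nat \<Rightarrow> complex" and \<beta> :: "nat \<Rightarrow> real" and f :: "real \<Rightarrow> complex"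
  assumes N: "N \<ge> 1" and l: "l > 1" and mono: "strict_mono_on {0..N} \<beta>"
    and int: "integrable lebesgue f" and nz: "\<not> (AE x in lebesgue. f x = 0)"
    and supp: "ae_compact_support f"
    and eq: "AE x in lebesgue. f x = (\<Sum>k=0..N. c k * f (l * x - \<beta> k))"
  defines "a \<equiv> inverse (l - 1) * \<beta> 0"
  shows "cmod (c 0) < l"
    and "\<mu> \<ge> 0 \<Longrightarrow> ae_bounded_near (\<lambda>x. cmod (f x) / \<bar>x - a\<bar> powr \<mu>) a
      \<Longrightarrow> cmod (c 0) \<le> l powr - \<mu>"
proof -
  obtain K where K: "compact K" "AE x in lebesgue. x \<notin> K \<longrightarrow> f x = 0"
    using supp unfolding ae_compact_support_def by blast
  obtain m where m: "\<And>x. x \<in> K \<Longrightarrow> m \<le> x"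
    using bounded_imp_bdd_below[OF compact_imp_bounded[OF K(1)]] unfolding bdd_below_def by blast
  have "AE x in lebesgue. x < m \<longrightarrow> f x = 0"
    using K(2) by eventually_elim (use m in force)
  then obtain s where s: "\<And>u. (AE x in lebesgue. x < u \<longrightarrow> f x = 0) \<longleftrightarrow> u \<le> s"
    using essential_support_left_end[OF nz] by metis
  have zero: "AE x in lebesgue. x < s \<longrightarrow> f x = 0" using s by blast
  \<comment> \<open>The map \<open>x \<mapsto> l * x - \<beta> k\<close> sends \<open>t k\<close> to
    \<open>s\<close>, so the \<open>k\<close>-th term vanishes almost everywhere left of
    \<open>t k\<close>. The \<open>t k\<close> increase with \<open>k\<close>, hence left of
    \<open>t 1\<close> only the term with index 0 survives.\<close>
  define t where "t k = (s + \<beta> k) / l" for k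
  have lt: "l * x - \<beta> k < s \<longleftrightarrow> x < t k" for x k
    using l by (auto simp: t_def field_simps)
  have t01: "t 0 < t 1"
    using strict_mono_onD[OF mono, of 0 1] N l by (simp add: t_def divide_strict_right_mono)
  have t1: "t 1 \<le> t k" if "1 \<le> k" "k \<le> N" for k
    using strict_mono_onD[OF mono, of 1 k] that l
    by (cases "k = 1") (simp_all add: t_def divide_right_mono)
  have zk: "AE x in lebesgue. \<forall>k. x < t k \<longrightarrow> f (l * x - \<beta> k) = 0"
    unfolding AE_all_countable
  proof
    fix k
    show "AE x in lebesgue. x < t k \<longrightarrow> f (l * x - \<beta> k) = 0"
      using AE_lebesgue_affine[OF _ zero, of l "- \<beta> k"] l
      by (simp add: lt[symmetric])
  qed
  have first: "AE x in lebesgue. x < t 1 \<longrightarrow> f x = c 0 * f (l * x - \<beta> 0)"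
    using eq zk
  proof eventually_elim
    case (elim x)
    show ?case
    proof
      assume x: "x < t 1"
      have "(\<Sum>k=0..N. c k * f (l * x - \<beta> k)) = (\<Sum>k\<in>{0}. c k * f (l * x - \<beta> k))"
      proof (rule sum.mono_neutral_right)
        show "\<forall>k\<in>{0..N} - {0}. c k * f (l * x - \<beta> k) = 0"
        proof
          fix k assume "k \<in> {0..N} - {0}"
          then have "x < t k" using t1[of k] x by auto
          then show "c k * f (l * x - \<beta> k) = 0" using elim(2) by simp
        qed
      qed auto
      then show "f x = c 0 * f (l * x - \<beta> 0)" using elim(1) by simp
    qed
  qed
  have fixpt: "s = t 0" if c0: "c 0 \<noteq> 0"
  proof (rule antisym)
    \<comment> \<open>Left of \<open>t 0\<close> even the leftmost term vanishes, hence so does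
      \<open>f\<close>.\<close>
    show "t 0 \<le> s"
      unfolding s[symmetric] using first zk by eventually_elim (use t01 in auto)
    show "s \<le> t 0"
    proof (rule ccontr)
      assume st: "\<not> s \<le> t 0"
      \<comment> \<open>Left of \<open>s\<close> the function is 0, and left of \<open>t 1\<close>
        it equals its first term; as \<open>c 0 \<noteq> 0\<close>, that term's dilate of
        \<open>f\<close> vanishes left of \<open>u\<close>. Undoing the dilation, \<open>f\<close>
        vanishes left of \<open>l * u - \<beta> 0\<close>, which exceeds \<open>s\<close> because
        \<open>t 0 < u\<close>.\<close>
      define u where "u = min s (t 1)"
      have "AE x in lebesgue. x < u \<longrightarrow> f (l * x - \<beta> 0) = 0"
        using first zero by eventually_elim (use c0 in \<open>auto simp: u_def\<close>)
      then have "AE y in lebesgue. \<beta> 0 / l + 1 / l * y < u \<longrightarrow> f (l * (\<beta> 0 / l + 1 / l * y) - \<beta> 0) = 0"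
        by (rule AE_lebesgue_affine[rotated]) (use l in simp)
      then have "AE y in lebesgue. y < l * u - \<beta> 0 \<longrightarrow> f y = 0"
        by eventually_elim (use l in \<open>simp add: field_simps\<close>)
      then have "l * u - \<beta> 0 \<le> s" using s by blast
      moreover have "t 0 < u" using st t01 by (simp add: u_def)
      ultimately show False using lt[of u 0] l by (simp add: t_def field_simps)
    qed
  qed
  \<comment> \<open>The left end is tied to \<open>a\<close> only when
    \<open>c 0 \<noteq> 0\<close>; otherwise both bounds are trivial.\<close>
  have *: "l * s - \<beta> 0 = s" "s = a" if "c 0 \<noteq> 0"
  proof -
    show fx: "l * s - \<beta> 0 = s" using fixpt[OF that] l by (simp add: t_def field_simps)
    then have "s * (l - 1) = \<beta> 0" by (simp add: algebra_simps)
    then show "s = a" using l by (simp add: a_def field_simps)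
  qed
  have d: "t 1 - s > 0" if "c 0 \<noteq> 0" using fixpt[OF that] t01 by simp
  have first': "AE x in lebesgue. x < s + (t 1 - s) \<longrightarrow> f x = c 0 * f (l * x - \<beta> 0)"
    using first by simp
  note bounds = dilation_coefficient_bounds[OF l int s *(1) d first']
  show "cmod (c 0) < l" using bounds(1) l by (cases "c 0 = 0") auto
  show "cmod (c 0) \<le> l powr - \<mu>"
    if "\<mu> \<ge> 0" "ae_bounded_near (\<lambda>x. cmod (f x) / \<bar>x - a\<bar> powr \<mu>) a"
    using bounds(2)[of \<mu>] that *(2) by (cases "c 0 = 0") auto
qed

section \<open>Reflection and the right end\<close>

lemma ae_bounded_near_reflect:
  assumes "ae_bounded_near g a"
  shows "ae_bounded_near (\<lambda>x. g (- x)) (- a)"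
proof -
  obtain U M where U: "open U" "a \<in> U" "AE x in lebesgue. x \<in> U \<longrightarrow> \<bar>g x\<bar> \<le> M"
    using assms unfolding ae_bounded_near_def by blast
  have "open (uminus ` U)" "- a \<in> uminus ` U" using U by (auto intro: open_negations)
  moreover have "AE x in lebesgue. x \<in> uminus ` U \<longrightarrow> \<bar>g (- x)\<bar> \<le> M"
    using AE_lebesgue_uminus[OF U(3)] by eventually_elim auto
  ultimately show ?thesis unfolding ae_bounded_near_def by blast
qed

lemma ae_compact_support_reflect:
  assumes "ae_compact_support f"
  shows "ae_compact_support (\<lambda>x. f (- x))"
proof -
  obtain K where K: "compact K" "AE x in lebesgue. x \<notin> K \<longrightarrow> f x = 0"
    using assms unfolding ae_compact_support_def by blast
  have "AE x in lebesgue. x \<notin> uminus ` K \<longrightarrow> f (- x) = 0"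
    using AE_lebesgue_uminus[OF K(2)]
    by eventually_elim (metis image_eqI minus_minus)
  then show ?thesis unfolding ae_compact_support_def using compact_negations[OF K(1)] by blast
qed

theorem lemma2p1:
  fixes N :: nat and l :: real and c :: "nat \<Rightarrow> complex" and \<beta> :: "nat \<Rightarrow> real"
    and \<phi> :: "real \<Rightarrow> complex"
  assumes "N \<ge> 1"
    and "l > 1"
    and "strict_mono_on {0..N} \<beta>"
    and "integrable lebesgue \<phi>"
    and "\<not> (AE x in lebesgue. \<phi> x = 0)"
    and "ae_compact_support \<phi>"
    and "AE x in lebesgue. \<phi> x = (\<Sum>k=0..N. c k * \<phi> (l * x - \<beta> k))"
  shows "cmod (c 0) < l \<and> cmod (c N) < l \<and>
    (\<forall>\<mu>::real. \<mu> \<ge> 0 \<longrightarrow>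
      (let a = inverse (l - 1) * \<beta> 0 in
        ae_bounded_near (\<lambda>x. cmod (\<phi> x) / \<bar>x - a\<bar> powr \<mu>) a
          \<longrightarrow> cmod (c 0) \<le> l powr (- \<mu>)) \<and>
      (let a = inverse (l - 1) * \<beta> N in
        ae_bounded_near (\<lambda>x. cmod (\<phi> x) / \<bar>x - a\<bar> powr \<mu>) a
          \<longrightarrow> cmod (c N) \<le> l powr (- \<mu>)))"
proof -
  \<comment> \<open>Reflection reverses the order of the terms: negating the shifts and replacing
    \<open>k\<close> by \<open>N - k\<close> keeps them increasing, and the last coefficient becomes
    the first.\<close>
  define f where "f = (\<lambda>x. \<phi> (- x))"
  define c' where "c' k = c (N - k)" for k
  define \<beta>' where "\<beta>' k = - \<beta> (N - k)" for k
  have mono: "strict_mono_on {0..N} \<beta>'"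
    using assms(3) by (auto simp: strict_mono_on_def \<beta>'_def)
  have int: "integrable lebesgue f"
    using lebesgue_integrable_real_affine[OF assms(4), of "- 1" 0] by (simp add: f_def)
  have nz: "\<not> (AE x in lebesgue. f x = 0)"
    using AE_lebesgue_uminus[of "\<lambda>x. f x = 0"] assms(5) by (auto simp: f_def)
  have supp: "ae_compact_support f"
    unfolding f_def by (rule ae_compact_support_reflect) fact
  have eq: "AE x in lebesgue. f x = (\<Sum>k=0..N. c' k * f (l * x - \<beta>' k))"
    using AE_lebesgue_uminus[OF assms(7)]
  proof eventually_elim
    case (elim x)
    have "(\<Sum>k=0..N. c k * \<phi> (l * (- x) - \<beta> k)) = (\<Sum>k=0..N. c' k * f (l * x - \<beta>' k))"
      unfolding c'_def f_def \<beta>'_def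
      by (rule sum.reindex_bij_witness[of _ "\<lambda>k. N - k" "\<lambda>k. N - k"]) auto
    then show ?case using elim by (simp add: f_def)
  qed
  note left = refinement_left_coefficient[OF assms]
  note right = refinement_left_coefficient[OF assms(1,2) mono int nz supp eq]
  have "cmod (c N) \<le> l powr - \<mu>"
    if "\<mu> \<ge> 0" "ae_bounded_near (\<lambda>x. cmod (\<phi> x) / \<bar>x - a\<bar> powr \<mu>) a"
      and a: "a = inverse (l - 1) * \<beta> N" for \<mu> a
  proof -
    have "\<bar>- x - a\<bar> = \<bar>x - - a\<bar>" for x by arith
    then have "ae_bounded_near (\<lambda>x. cmod (f x) / \<bar>x - - a\<bar> powr \<mu>) (- a)"
      using ae_bounded_near_reflect[OF that(2)] by (simp add: f_def)
    moreover have "- a = inverse (l - 1) * \<beta>' 0" by (simp add: a \<beta>'_def)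
    ultimately show ?thesis using right(2)[OF that(1)] by (simp add: c'_def)
  qed
  moreover have "cmod (c N) < l" using right(1) by (simp add: c'_def)
  ultimately show ?thesis using left by (auto simp: Let_def)
qed

end
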